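(* Let $C$ be a $2$-torsion free commutative ring with unity, let $n\geq 2$, and let $\mathcal{M}_n(C)$ be the $C$-algebra of $n\times n$ matrices over $C$. Let $f,g:\mathcal{M}_n(C)\to\mathcal{M}_n(C)$ be $C$-linear maps. Then $f$ is a left $\{g,g\}$-derivation if and only if $f=g=0$.
   Context: A ring $R$ is $2$-torsion free if $2a=0$ with $a\in R$ implies $a=0$. For an algebra $A$ over $C$ and $C$-linear maps $f,g,h:A\to A$, $f$ is a left $\{g,h\}$-derivation if $f(ab)=a\,g(b)+b\,h(a)=a\,h(b)+b\,g(a)$ for all $a,b\in A$; a left $\{g,g\}$-derivation is the case $h=g$. *)

theory Defs
  imports "HOL-Analysis.Analysis"
begin

text \<open>Scalar multiplication on matrices. The library's vector operation \<open>(*s)\<close> multiplies by an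
  element of the component type, so on \<open>'c^'n^'m\<close> it would take a row, not a scalar of \<open>'c\<close>.\<close>

definition matrix_smult :: "'c::comm_ring_1 \<Rightarrow> 'c^'n^'m \<Rightarrow> 'c^'n^'m"
  where "matrix_smult c A = (\<chi> i j. c * A $ i $ j)"

lemma module_matrix_smult: "module matrix_smult"
  by (simp add: module_def matrix_smult_def vec_eq_iff algebra_simps)

lemma matrix_smult_mult_left: "matrix_smult c A ** B = matrix_smult c (A ** B)"
  by (simp add: matrix_smult_def matrix_matrix_mult_def vec_eq_iff sum_distrib_left mult.assoc)

lemma matrix_smult_mult_right: "A ** matrix_smult c B = matrix_smult c (A ** B)"
  by (simp add: matrix_smult_def matrix_matrix_mult_def vec_eq_iff sum_distrib_left
      mult.left_commute)

text \<open>The product of the algebra is a parameter because the type class product on \<open>'c^'n^'n\<close> is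
  componentwise; matrix multiplication is \<open>(**)\<close>. Linearity of \<open>f\<close>, \<open>g\<close> and \<open>h\<close> is not part of the
  predicate but assumed separately, as \<open>module_hom\<close>.\<close>

definition left_gh_derivation ::
  "('a::ab_group_add \<Rightarrow> 'a \<Rightarrow> 'a) \<Rightarrow> ('a \<Rightarrow> 'a) \<Rightarrow> ('a \<Rightarrow> 'a) \<Rightarrow> ('a \<Rightarrow> 'a) \<Rightarrow> bool"
  where "left_gh_derivation mul g h f \<longleftrightarrow>
    (\<forall>a b. f (mul a b) = mul a (g b) + mul b (h a) \<and>
           f (mul a b) = mul a (h b) + mul b (g a))"

end

(* Symmetry in a and b makes f(ab) = f(ba), so f vanishes on off-diagonal matrix units and takes the
   same value on all diagonal ones. Since f(e) = 2 e g(e) for e = E_ii, that common value is supported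
   on row i for every i; as there are at least two rows, it is 0. Hence f = 0, and then
   0 = f(1) = 2 g(1) gives g(b) = f(b) - b g(1) = 0. *)

theory Submission
  imports Defs
begin

definition matrix_unit :: "'n \<Rightarrow> 'm \<Rightarrow> 'c::comm_ring_1^'m^'n"
  where "matrix_unit i j = (\<chi> k l. if k = i \<and> l = j then 1 else 0)"

text \<open>Only row \<open>j\<close> of \<open>B\<close> survives, moved to row \<open>i\<close>;
  hence every product \<open>matrix_unit i i ** X\<close> is supported on row
  \<open>i\<close>.\<close>

lemma matrix_unit_mult_nth:
  "(matrix_unit i j ** B) $ k $ l = (if k = i then B $ j $ l else 0)"
  by (simp add: matrix_matrix_mult_def matrix_unit_def if_distrib[where f = "\<lambda>x. x * _"]
      cong: if_cong)

lemma matrix_unit_mult: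
  "matrix_unit i j ** matrix_unit k l = (if j = k then matrix_unit i l else 0)"
  by (simp add: vec_eq_iff matrix_unit_mult_nth) (simp add: matrix_unit_def)

lemma matrix_eq_sum_matrix_unit:
  "A = (\<Sum>i\<in>UNIV. \<Sum>j\<in>UNIV. matrix_smult (A $ i $ j) (matrix_unit i j))"
proof -
  have "(\<Sum>i\<in>UNIV. \<Sum>j\<in>UNIV. matrix_smult (A $ i $ j) (matrix_unit i j)) $ k $ l = A $ k $ l"
    for k l
  proof -
    \<comment> \<open>The conditions are nested so that the inner sum collapses at
      \<open>j = l\<close> and then the outer one at \<open>i = k\<close>.\<close>
    have "(\<Sum>i\<in>UNIV. \<Sum>j\<in>UNIV. matrix_smult (A $ i $ j) (matrix_unit i j)) $ k $ l
        = (\<Sum>i\<in>UNIV. \<Sum>j\<in>UNIV. if j = l then (if i = k then A $ k $ l else 0) else 0)"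
      unfolding sum_component by (intro sum.cong) (auto simp: matrix_smult_def matrix_unit_def)
    then show ?thesis by simp
  qed
  then show ?thesis by (simp add: vec_eq_iff)
qed

text \<open>Matrix units span, so linearity carries vanishing on them to all matrices.\<close>

lemma module_hom_eq_zero_if_matrix_unit:
  assumes "module_hom matrix_smult s f" and "\<And>i j. f (matrix_unit i j) = 0"
  shows "f A = 0"
proof -
  interpret module_hom matrix_smult s f by fact
  show ?thesis
    by (subst matrix_eq_sum_matrix_unit) (simp add: sum scale assms(2))
qed

theorem theorem2p12:
  fixes f g :: "'c::comm_ring_1^'n^'n \<Rightarrow> 'c^'n^'n"
  assumes "\<forall>a::'c. 2 * a = 0 \<longrightarrow> a = 0"
    and "CARD('n) \<ge> 2"
    and "module_hom matrix_smult matrix_smult f"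
    and "module_hom matrix_smult matrix_smult g"
  shows "left_gh_derivation (**) g g f \<longleftrightarrow> f = (\<lambda>_. 0) \<and> g = (\<lambda>_. 0)"
proof
  assume "left_gh_derivation (**) g g f"
  then have D: "f (a ** b) = a ** g b + b ** g a" for a b
    by (simp add: left_gh_derivation_def)
  have comm: "f (a ** b) = f (b ** a)" for a b
    by (simp add: D add.commute)
  interpret f: module_hom matrix_smult matrix_smult f by fact
  have off: "f (matrix_unit i j) = 0" if "i \<noteq> j" for i j
    \<comment> \<open>In one order the product is \<open>matrix_unit i j\<close>, in the other it is
      0.\<close>
    using comm[of "matrix_unit i i" "matrix_unit i j"] that
    by (simp add: matrix_unit_mult f.zero)
  have diag_eq: "f (matrix_unit i i) = f (matrix_unit j j)" for i j
    using comm[of "matrix_unit i j" "matrix_unit j i"] by (simp add: matrix_unit_mult)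
  have row: "f (matrix_unit i i) $ k = 0" if "k \<noteq> i" for i k
    using D[of "matrix_unit i i" "matrix_unit i i"] that
    by (simp add: matrix_unit_mult vec_eq_iff matrix_unit_mult_nth)
  have diag: "f (matrix_unit i i) = 0" for i
  proof -
    \<comment> \<open>To kill row \<open>k\<close>, replace \<open>matrix_unit i i\<close> by
      \<open>matrix_unit j j\<close> with \<open>j \<noteq> k\<close>.\<close>
    have "\<exists>j. j \<noteq> k" for k :: 'n
    proof (rule ccontr)
      assume "\<nexists>j. j \<noteq> k"
      then have "(UNIV :: 'n set) = {k}" by auto
      then have "CARD('n) = 1" by (metis card_1_singleton_iff One_nat_def)
      with assms(2) show False by simp
    qed
    then have "f (matrix_unit i i) $ k = 0" for k
      using row diag_eq by metis
    then show ?thesis by (simp add: vec_eq_iff)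
  qed
  have f0: "f a = 0" for a
    using module_hom_eq_zero_if_matrix_unit[OF assms(3)] off diag by metis
  have "g (mat 1) + g (mat 1) = 0"
    using D[of "mat 1" "mat 1"] by (simp add: f0)
  then have "g (mat 1) = 0"
    \<comment> \<open>Torsion-freeness concerns scalars, so it is applied to each entry.\<close>
    using assms(1) unfolding vec_eq_iff vector_add_component zero_index by (metis mult_2)
  then have "g a = 0" for a
    using D[of "mat 1" a] by (simp add: f0)
  with f0 show "f = (\<lambda>_. 0) \<and> g = (\<lambda>_. 0)" by auto
qed (simp add: left_gh_derivation_def)

end
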